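(* Let $k\geq 3$ be an integer and let $G=(V,E)$ be a graph on $n$ vertices with girth at least $2k+1$. Define $V_{low}=\{v\in V: d_1(v)\leq n^{1/k}\}$, $V_{med}=\{v\in V: n^{(k-2)/(k-1)}d_1(v)^{1/(k-1)}\leq d_{k-1}(v)\}$, and for each integer $0\leq j\leq\lfloor (k-3)/2\rfloor$, $V_{high,j}=\{v\in V: d_{k-2j-1}(v)\leq n^{1/(k-1)}d_{k-2j-3}(v)\,d_1(v)^{(k-2)/(k-1)}\}$. Then $V=V_{low}\cup V_{med}\cup\bigcup_{0\leq j\leq\lfloor(k-3)/2\rfloor}V_{high,j}$.
   Context: For a vertex $v$ and integer $i\geq 0$, $N_i(v)$ is the set of vertices at hop distance exactly $i$ from $v$ and $d_i(v)=|N_i(v)|$; in particular $d_0(v)=1$ and $d_1(v)$ is the degree of $v$. The girth is the length of a shortest cycle (infinite for acyclic graphs). *)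

theory Defs
  imports Graph_Theory.Shortest_Path "HOL-Library.Extended_Nat" Complex_Main
begin

text \<open>
  A finite simple undirected graph is represented by the locale \<^term>\<open>graph\<close>: a finite symmetric
  digraph without loops and parallel arcs, so every undirected edge is a pair of opposite arcs.
\<close>

definition hop_dist :: "('a, 'b) pre_digraph \<Rightarrow> 'a \<Rightarrow> 'a \<Rightarrow> ereal" where
  "hop_dist G u v = wf_digraph.\<mu> G (\<lambda>_. 1) u v"

definition N_at :: "('a, 'b) pre_digraph \<Rightarrow> nat \<Rightarrow> 'a \<Rightarrow> 'a set" where
  "N_at G i v = {u \<in> verts G. hop_dist G v u = ereal (real i)}"

definition d_at :: "('a, 'b) pre_digraph \<Rightarrow> nat \<Rightarrow> 'a \<Rightarrow> nat" where
  "d_at G i v = card (N_at G i v)"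

text \<open>
  The library predicate \<^const>\<open>pre_digraph.cycle\<close> also accepts the closed walk along an edge and
  straight back, which is not a cycle of the undirected graph; hence the bound on the length.
  The infimum of the empty set is \<open>\<infinity>\<close>, the girth of an acyclic graph.
\<close>

definition girth :: "('a, 'b) pre_digraph \<Rightarrow> enat" where
  "girth G = (INF p\<in>{p. pre_digraph.cycle G p \<and> 3 \<le> length p}. enat (length p))"

definition V_low :: "('a, 'b) pre_digraph \<Rightarrow> nat \<Rightarrow> 'a set" where
  "V_low G k = {v \<in> verts G. real (d_at G 1 v) \<le> real (card (verts G)) powr (1 / real k)}"

definition V_med :: "('a, 'b) pre_digraph \<Rightarrow> nat \<Rightarrow> 'a set" where
  "V_med G k = {v \<in> verts G.
     real (card (verts G)) powr ((real k - 2) / (real k - 1)) * real (d_at G 1 v) powr (1 / (real k - 1))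
       \<le> real (d_at G (k - 1) v)}"

text \<open>The truncated subtractions are exact in the intended range \<open>3 \<le> k\<close>, \<open>j \<le> (k - 3) div 2\<close>.\<close>

definition V_high :: "('a, 'b) pre_digraph \<Rightarrow> nat \<Rightarrow> nat \<Rightarrow> 'a set" where
  "V_high G k j = {v \<in> verts G.
     real (d_at G (k - 2 * j - 1) v)
       \<le> real (card (verts G)) powr (1 / (real k - 1)) * real (d_at G (k - 2 * j - 3) v)
           * real (d_at G 1 v) powr ((real k - 2) / (real k - 1))}"

end

theory Submission
  imports Defs
begin

text \<open>
  A vertex outside all \<open>V_high G k j\<close> satisfies \<open>d\<^bsub>k-1-2j\<^esub> > c d\<^bsub>k-3-2j\<^esub>\<close> with
  \<open>c = n\<^bsup>1/(k-1)\<^esup> d\<^sub>1\<^bsup>(k-2)/(k-1)\<^esup>\<close>. Telescoping these \<open>m = \<lfloor>(k-1)/2\<rfloor>\<close> inequalities gives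
  \<open>d\<^bsub>k-1\<^esub> \<ge> c\<^sup>m d\<^sub>r\<close> with \<open>r = k-1-2m \<in> {0,1}\<close>, where \<open>d\<^sub>r = d\<^sub>1\<^sup>r\<close>. Outside \<open>V_low G k\<close> one has \<open>n \<le> d\<^sub>1\<^sup>k\<close>,
  and trading \<open>n\<close> for \<open>d\<^sub>1\<close> in the exponent \<open>(k-2-m)/(k-1)\<close> turns this into the bound
  defining \<open>V_med G k\<close>.
\<close>

text \<open>The empty walk gives the upper bound; nonnegative weights keep every closed walk from
  having negative cost.\<close>

lemma (in wf_digraph) \<mu>_self:
  assumes "u \<in> verts G" "\<And>e. e \<in> arcs G \<Longrightarrow> 0 \<le> w e"
  shows "\<mu> w u u = 0"
proof (rule antisym)
  show "\<mu> w u u \<le> 0"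
    using min_cost_le_walk_cost[of u "[]" u w] assms(1) by (simp add: awalk_Nil_iff zero_ereal_def)
  have "0 \<le> awalk_cost w p" if "awalk u p u" for p
    using that assms(2) by (auto intro!: pos_cost_pos_awalk_cost)
  then show "0 \<le> \<mu> w u u"
    unfolding \<mu>_def by (auto intro!: INF_greatest)
qed

lemma one_le_d_at_0:
  assumes "fin_digraph G" "v \<in> verts G"
  shows "1 \<le> d_at G 0 v"
proof -
  interpret fin_digraph G by fact
  have "v \<in> N_at G 0 v"
    using \<mu>_self[OF assms(2), of "\<lambda>_. 1"] assms(2)
    by (simp add: N_at_def hop_dist_def zero_ereal_def)
  moreover have "finite (N_at G 0 v)"
    unfolding N_at_def by simp
  ultimately show ?thesis
    unfolding d_at_def by (metis One_nat_def Suc_leI card_gt_0_iff empty_iff)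
qed

lemma power_mult_le_telescope:
  fixes f :: "nat \<Rightarrow> real"
  assumes "0 \<le> c" "\<And>j. j < m \<Longrightarrow> c * f (Suc j) \<le> f j"
  shows "c ^ m * f m \<le> f 0"
  using assms(2)
proof (induction m)
  case (Suc m)
  have "c ^ Suc m * f (Suc m) \<le> c ^ m * f m"
    using mult_left_mono[OF Suc.prems[of m], of "c ^ m"] assms(1) by (simp add: mult_ac)
  also have "\<dots> \<le> f 0"
    using Suc by simp
  finally show ?case .
qed simp

text \<open>Split the exponent of \<open>n\<close> as \<open>m / (k - 1) + e\<close>. The first part
  already occurs on the right; the second is absorbed into \<open>d\<close> by
  \<open>n \<le> d powr k\<close>, where \<open>m \<le> k - 2\<close> gives
  \<open>0 \<le> e\<close>.\<close>

lemma powr_exchange: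
  fixes n d :: real
  assumes "1 \<le> n" "n powr (1 / real k) \<le> d" "2 \<le> k" "m \<le> k - 2" "2 * m + r = k - 1"
  shows "n powr ((real k - 2) / (real k - 1)) * d powr (1 / (real k - 1))
    \<le> (n powr (1 / (real k - 1)) * d powr ((real k - 2) / (real k - 1))) ^ m * d ^ r"
proof -
  define e where "e = (real k - 2 - real m) / (real k - 1)"
  have k1: "real k - 1 > 0" and e: "0 \<le> e"
    using assms(3,4) by (auto simp: e_def)
  \<comment> \<open>Strict positivity of \<open>d\<close> allows passing between \<open>powr\<close>
    and \<open>^\<close>: for \<open>r = 0\<close> the two differ at 0, as
    \<open>0 powr 0 = 0\<close>.\<close>
  have "1 \<le> n powr (1 / real k)"
    using assms(1,3) by (simp add: ge_one_powr_ge_zero)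
  then have d: "0 < d"
    using assms(2) by linarith
  have "n = (n powr (1 / real k)) powr real k"
    using assms(1,3) by (simp add: powr_powr)
  also have "\<dots> \<le> d powr real k"
    using assms(2) by (intro powr_mono2) auto
  finally have "n powr e \<le> (d powr real k) powr e"
    using assms(1) e by (intro powr_mono2) auto
  then have n_le: "n powr e \<le> d powr (real k * e)"
    by (simp add: powr_powr)
  have r: "real r = real k - 1 - 2 * real m"
    using assms(3,5) by linarith
  have en: "(real k - 2) / (real k - 1) = real m / (real k - 1) + e"
    by (simp add: e_def add_divide_distrib[symmetric])
  have "real k * e + 1 / (real k - 1) = (real k * (real k - 2 - real m) + 1) / (real k - 1)"
    by (simp add: e_def add_divide_distrib)
  \<comment> \<open>With \<open>r = k - 1 - 2 * m\<close>, both numerators equal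
    \<open>(k - 1)^2 - k * m\<close>, so the powers of \<open>d\<close> match exactly.\<close>
  also have "\<dots> = ((real k - 2) * real m + real r * (real k - 1)) / (real k - 1)"
    unfolding r by (simp add: algebra_simps)
  also have "\<dots> = (real k - 2) / (real k - 1) * real m + real r"
    using k1 by (simp add: add_divide_distrib)
  finally have ed: "real k * e + 1 / (real k - 1) = (real k - 2) / (real k - 1) * real m + real r" .
  have "n powr ((real k - 2) / (real k - 1)) * d powr (1 / (real k - 1))
      = n powr (real m / (real k - 1)) * (n powr e * d powr (1 / (real k - 1)))"
    by (subst en) (simp add: powr_add)
  also have "\<dots> \<le> n powr (real m / (real k - 1)) * (d powr (real k * e) * d powr (1 / (real k - 1)))"
    using n_le by (intro mult_left_mono mult_right_mono) auto
  also have "\<dots> = n powr (real m / (real k - 1)) * (d powr ((real k - 2) / (real k - 1) * real m) * d ^ r)"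
    using d by (simp only: powr_add[symmetric] ed) (simp add: powr_add powr_realpow)
  also have "\<dots> = (n powr (1 / (real k - 1)) * d powr ((real k - 2) / (real k - 1))) ^ m * d ^ r"
    using assms(1) d by (simp add: power_mult_distrib powr_powr flip: powr_realpow)
  finally show ?thesis .
qed

theorem theorem7:
  fixes G :: "('a, 'b) pre_digraph" and k :: nat
  assumes "k \<ge> 3"
    and "graph G"
    and "girth G \<ge> enat (2 * k + 1)"
  shows "verts G = V_low G k \<union> V_med G k \<union> (\<Union>j\<in>{0..(k - 3) div 2}. V_high G k j)"
proof
  interpret graph G by fact
  show "verts G \<subseteq> V_low G k \<union> V_med G k \<union> (\<Union>j\<in>{0..(k - 3) div 2}. V_high G k j)"
  proof (rule subsetI, rule ccontr)
    fix v
    assume v: "v \<in> verts G"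
      and out: "v \<notin> V_low G k \<union> V_med G k \<union> (\<Union>j\<in>{0..(k - 3) div 2}. V_high G k j)"
    define n where "n = real (card (verts G))"
    define d where "d = real (d_at G 1 v)"
    define c where "c = n powr (1 / (real k - 1)) * d powr ((real k - 2) / (real k - 1))"
    define m where "m = (k - 1) div 2"
    define r where "r = (k - 1) mod 2"
    have mr: "2 * m + r = k - 1"
      by (simp add: m_def r_def)
    have n: "1 \<le> n"
      using v by (simp add: n_def Suc_le_eq card_gt_0_iff) auto
    have low: "n powr (1 / real k) \<le> d"
      using out v by (simp add: V_low_def n_def d_def)
    have "c * real (d_at G (k - 1 - 2 * Suc j) v) \<le> real (d_at G (k - 1 - 2 * j) v)" if "j < m" for j
    proof -
      \<comment> \<open>As \<open>k \<ge> 3\<close>, \<open>m = (k - 3) div 2 + 1\<close>, so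
        \<open>j < m\<close> is exactly the index range of the union.\<close>
      have "j \<le> (k - 3) div 2"
        using that assms(1) by (simp add: m_def)
      then have "v \<notin> V_high G k j"
        using out by auto
      moreover have "k - 2 * j - 1 = k - 1 - 2 * j" "k - 2 * j - 3 = k - 1 - 2 * Suc j"
        by simp_all
      ultimately show ?thesis
        using v by (simp add: V_high_def c_def n_def d_def mult_ac)
    qed
    then have "c ^ m * real (d_at G (k - 1 - 2 * m) v) \<le> real (d_at G (k - 1 - 2 * 0) v)"
      by (intro power_mult_le_telescope[where f = "\<lambda>j. real (d_at G (k - 1 - 2 * j) v)"])
        (simp_all add: c_def)
    moreover have "k - 1 - 2 * m = r"
      using mr by linarith
    ultimately have "c ^ m * real (d_at G r v) \<le> real (d_at G (k - 1) v)"
      by simp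
    \<comment> \<open>The chain ends at distance 0 for odd \<open>k\<close> and at distance 1 for
      even \<open>k\<close>; at 0 the bound \<open>1 \<le> d_at G 0 v\<close> suffices.\<close>
    moreover have "d ^ r \<le> real (d_at G r v)"
    proof (cases "r = 0")
      case True
      then show ?thesis
        using one_le_d_at_0[OF fin_digraph_axioms v] by simp
    next
      case False
      then have "r = 1"
        by (simp add: r_def)
      then show ?thesis
        by (simp add: d_def)
    qed
    then have "c ^ m * d ^ r \<le> c ^ m * real (d_at G r v)"
      by (intro mult_left_mono) (simp_all add: c_def)
    moreover have "n powr ((real k - 2) / (real k - 1)) * d powr (1 / (real k - 1)) \<le> c ^ m * d ^ r"
      unfolding c_def using assms(1) by (intro powr_exchange n low mr) (auto simp: m_def)
    ultimately have "v \<in> V_med G k"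
      using v by (simp add: V_med_def n_def d_def)
    with out show False
      by simp
  qed
qed (auto simp: V_low_def V_med_def V_high_def)

end
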